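(* Let $a,b,c\in\mathbb{R}$ with $a\neq 0$, let $g:\mathbb{R}\to\mathbb{R}$, $g(x)=ax^2+bx+c$, and let $\delta:=b^2-4ac-2b-7$. Let $(x,y,z)$ be a representative of a 3-cycle of the map $x_{t+1}=g(x_t)$ and let $r=\frac{z-y}{y-x}$. Let $q^{\langle0\rangle}_1<q^{\langle0\rangle}_2<q^{\langle0\rangle}_3$ be the roots of $Q_0(X)=X^3+X^2-2X-1$, so $q^{\langle0\rangle}_1\approx-1.801$, $q^{\langle0\rangle}_2\approx-0.445$, $q^{\langle0\rangle}_3\approx1.246$. Then: (i) $\delta=0$ if and only if $r\in\{q^{\langle0\rangle}_1,q^{\langle0\rangle}_2,q^{\langle0\rangle}_3\}$. (ii) $\delta>0$ and $(x,y,z)$ is a representative of $\mathcal{C}_{\langle\delta\rangle}$ if and only if $r\in(q^{\langle0\rangle}_1,-1)\cup(q^{\langle0\rangle}_2,0)\cup(q^{\langle0\rangle}_3,\infty)$. (iii) $\delta>0$ and $(x,y,z)$ is a representative of $\mathcal{C}_{\langle-\delta\rangle}$ if and only if $r\in(-\infty,q^{\langle0\rangle}_1)\cup(-1,q^{\langle0\rangle}_2)\cup(0,q^{\langle0\rangle}_3)$.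
   Context: A 3-cycle of the map $x_{t+1}=g(x_t)$ is the class, modulo cyclic permutation, of an ordered triple $(x,y,z)$ of pairwise distinct real numbers with $g(x)=y$, $g(y)=z$, $g(z)=x$; any such triple is called a representative of the 3-cycle, and $x,y,z$ are its points. For $\beta\in\mathbb{R}$ let $Q_\beta(X)=X^3+(1-\beta)X^2-(2+\beta)X-1$. All roots of $Q_\beta$ are real, distinct and nonzero; they are denoted $q^{\langle\beta\rangle}_1<q^{\langle\beta\rangle}_2<q^{\langle\beta\rangle}_3$. If $\delta<0$ the map has no 3-cycle, and if $\delta=0$ it has exactly one. For $\delta>0$ the map has exactly two 3-cycles: $\mathcal{C}_{\langle\delta\rangle}$, whose points are $\frac{-b+\sqrt{\delta}+1}{2a}+\frac{1}{a q^{\langle\sqrt{\delta}\rangle}_i}$, and $\mathcal{C}_{\langle-\delta\rangle}$, whose points are $\frac{-b-\sqrt{\delta}+1}{2a}+\frac{1}{a q^{\langle-\sqrt{\delta}\rangle}_i}$, $i\in\{1,2,3\}$. *)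

theory Defs
  imports Complex_Main "HOL-Computational_Algebra.Polynomial"
begin

definition quad_map :: "real \<Rightarrow> real \<Rightarrow> real \<Rightarrow> real \<Rightarrow> real" where
  "quad_map a b c x = a * x\<^sup>2 + b * x + c"

definition delta :: "real \<Rightarrow> real \<Rightarrow> real \<Rightarrow> real" where
  "delta a b c = b\<^sup>2 - 4 * a * c - 2 * b - 7"

definition is_rep3 :: "(real \<Rightarrow> real) \<Rightarrow> real \<times> real \<times> real \<Rightarrow> bool" where
  "is_rep3 g = (\<lambda>(x, y, z). x \<noteq> y \<and> y \<noteq> z \<and> x \<noteq> z \<and> g x = y \<and> g y = z \<and> g z = x)"

definition cyclic_class :: "real \<times> real \<times> real \<Rightarrow> (real \<times> real \<times> real) set" where
  "cyclic_class = (\<lambda>(x, y, z). {(x, y, z), (y, z, x), (z, x, y)})"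

text \<open>A 3-cycle is the set of its representatives, so that being a representative of
  a 3-cycle is membership.\<close>

definition three_cycles :: "(real \<Rightarrow> real) \<Rightarrow> (real \<times> real \<times> real) set set" where
  "three_cycles g = cyclic_class ` {t. is_rep3 g t}"

definition cycle_points :: "(real \<times> real \<times> real) set \<Rightarrow> real set" where
  "cycle_points C = (\<Union>(x, y, z)\<in>C. {x, y, z})"

definition Q :: "real \<Rightarrow> real poly" where
  "Q \<beta> = [:- 1, - (2 + \<beta>), 1 - \<beta>, 1:]"

text \<open>The \<open>i\<close>-th smallest root, \<open>i \<in> {1, 2, 3}\<close>. There are always three real roots, since
  \<open>Q \<beta>\<close> takes the value \<open>1\<close> at \<open>- 1\<close> and \<open>- 1\<close> at \<open>0\<close>.\<close>

definition qroot :: "real \<Rightarrow> nat \<Rightarrow> real" where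
  "qroot \<beta> i = sorted_list_of_set {u. poly (Q \<beta>) u = 0} ! (i - 1)"

text \<open>The 3-cycle with the prescribed points, for \<open>\<beta> = \<plusminus> sqrt (delta a b c)\<close>. It is unique because
  the map determines the order of the points up to cyclic permutation; it exists
  whenever \<open>a \<noteq> 0\<close> and \<open>\<beta>\<^sup>2 = delta a b c\<close>.\<close>

definition cycle_of :: "real \<Rightarrow> real \<Rightarrow> real \<Rightarrow> real \<Rightarrow> (real \<times> real \<times> real) set" where
  "cycle_of a b c \<beta> = (THE C. C \<in> three_cycles (quad_map a b c) \<and>
     cycle_points C = (\<lambda>i. (- b + \<beta> + 1) / (2 * a) + 1 / (a * qroot \<beta> i)) ` {1, 2, 3})"

definition C_pos :: "real \<Rightarrow> real \<Rightarrow> real \<Rightarrow> (real \<times> real \<times> real) set" where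
  "C_pos a b c = cycle_of a b c (sqrt (delta a b c))"

definition C_neg :: "real \<Rightarrow> real \<Rightarrow> real \<Rightarrow> (real \<times> real \<times> real) set" where
  "C_neg a b c = cycle_of a b c (- sqrt (delta a b c))"

end

theory Submission
  imports Defs
begin

text \<open>
  Successive ratios of differences along a 3-cycle are obtained from each other by the order-three
  map \<open>u \<mapsto> - (1 + u) / u\<close>, and this map permutes the roots of every \<open>Q \<beta>\<close>. If \<open>\<beta>\<^sup>2 = \<delta>\<close>, then
  \<open>u \<mapsto> (- b + \<beta> + 1) / (2 a) + 1 / (a u)\<close> conjugates this permutation of the roots to the quadratic
  map, and it sends the ratio \<open>r\<close> of a representative \<open>(x, y, z)\<close> to its first point \<open>x\<close>. Hence a
  representative belongs to the cycle with parameter \<open>\<beta>\<close> iff \<open>r\<close> is a root of \<open>Q \<beta>\<close>, that is, iff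
  \<open>\<beta> = Q\<^sub>0(r) / (r (r + 1))\<close>, and the theorem reads off the sign of this quotient.
\<close>

definition ratio_map :: "real \<Rightarrow> real" where
  "ratio_map u = - (1 + u) / u"

definition cycle_point :: "real \<Rightarrow> real \<Rightarrow> real \<Rightarrow> real \<Rightarrow> real" where
  "cycle_point a b \<beta> u = (- b + \<beta> + 1) / (2 * a) + 1 / (a * u)"

definition orbit_rep :: "real \<Rightarrow> real \<Rightarrow> real \<Rightarrow> real \<Rightarrow> real \<times> real \<times> real" where
  "orbit_rep a b \<beta> u = (cycle_point a b \<beta> u, cycle_point a b \<beta> (ratio_map u),
     cycle_point a b \<beta> (ratio_map (ratio_map u)))"

section \<open>Roots of the cubics \<open>Q \<beta>\<close>\<close>

lemma poly_Q: "poly (Q \<beta>) u = u ^ 3 + (1 - \<beta>) * u\<^sup>2 - (2 + \<beta>) * u - 1"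
  by (simp add: Q_def algebra_simps power2_eq_square power3_eq_cube)

text \<open>The parameter enters linearly, so a root \<open>u\<close> other than \<open>0\<close>
  and \<open>- 1\<close> determines \<open>\<beta>\<close>.\<close>

lemma poly_Q_0: "poly (Q \<beta>) u = poly (Q 0) u - \<beta> * (u * (u + 1))"
  by (simp add: poly_Q algebra_simps power2_eq_square)

text \<open>For every \<open>\<beta>\<close> the cubic takes the value \<open>- 1\<close> at
  \<open>0\<close> and \<open>1\<close> at \<open>- 1\<close>.\<close>

lemma Q_root_neq:
  assumes "poly (Q \<beta>) u = 0"
  shows "u \<noteq> 0" "u \<noteq> - 1"
  using assms by (auto simp: poly_Q)

lemma Q_root_iff:
  assumes "u \<noteq> 0" "u \<noteq> - 1"
  shows "poly (Q \<beta>) u = 0 \<longleftrightarrow> \<beta> = poly (Q 0) u / (u * (u + 1))"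
proof -
  have "u * (u + 1) \<noteq> 0"
    using assms by auto
  then show ?thesis
    unfolding poly_Q_0[of \<beta>] eq_divide_eq by auto
qed

lemma Q_factorization:
  assumes "poly (Q \<beta>) u = 0" "poly (Q \<beta>) v = 0" "poly (Q \<beta>) w = 0"
    and "u \<noteq> v" "v \<noteq> w" "u \<noteq> w"
  shows "poly (Q \<beta>) X = (X - u) * (X - v) * (X - w)"
proof -
  have split: "poly (Q \<beta>) X = (X - u) * (X - v) * (X + u + v + 1 - \<beta>)" for X
  proof -
    \<comment> \<open>The second factor is the divided difference of the cubic at \<open>u\<close>
      and \<open>v\<close>; it vanishes because both are roots.\<close>
    have "(v - u) * (v\<^sup>2 + v * u + u\<^sup>2 + (1 - \<beta>) * (v + u) - (2 + \<beta>)) = poly (Q \<beta>) v - poly (Q \<beta>) u"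
      unfolding poly_Q by algebra
    then have "v\<^sup>2 + v * u + u\<^sup>2 + (1 - \<beta>) * (v + u) - (2 + \<beta>) = 0"
      using assms by simp
    moreover have "poly (Q \<beta>) X - poly (Q \<beta>) u =
      (X - u) * (v\<^sup>2 + v * u + u\<^sup>2 + (1 - \<beta>) * (v + u) - (2 + \<beta>) + (X - v) * (X + u + v + 1 - \<beta>))"
      unfolding poly_Q by algebra
    ultimately show ?thesis
      using assms by simp
  qed
  have "w + u + v + 1 - \<beta> = 0"
    using split[of w] assms by simp
  then have "X + u + v + 1 - \<beta> = X - w"
    by simp
  then show ?thesis
    using split[of X] by simp
qed

lemma Q_roots_eq:
  assumes "poly (Q \<beta>) u = 0" "poly (Q \<beta>) v = 0" "poly (Q \<beta>) w = 0"
    and "u \<noteq> v" "v \<noteq> w" "u \<noteq> w"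
  shows "{X. poly (Q \<beta>) X = 0} = {u, v, w}"
  using Q_factorization[OF assms] by auto

lemma qroot_eq:
  assumes "poly (Q \<beta>) u = 0" "poly (Q \<beta>) v = 0" "poly (Q \<beta>) w = 0" "u < v" "v < w"
  shows "qroot \<beta> 1 = u" "qroot \<beta> 2 = v" "qroot \<beta> 3 = w"
proof -
  have "{X. poly (Q \<beta>) X = 0} = set [u, v, w]"
    using assms by (subst Q_roots_eq[of \<beta> u v w]) auto
  moreover have "sorted_list_of_set (set [u, v, w]) = [u, v, w]"
    using assms by (intro sorted_list_of_set.idem_if_sorted_distinct) auto
  ultimately have "sorted_list_of_set {X. poly (Q \<beta>) X = 0} = [u, v, w]"
    by simp
  then show "qroot \<beta> 1 = u" "qroot \<beta> 2 = v" "qroot \<beta> 3 = w"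
    by (simp_all add: qroot_def)
qed

text \<open>Only the set of roots matters here, so three roots can be supplied without knowing their
  order, as is the case for an orbit of \<open>ratio_map\<close>.\<close>

lemma qroot_image:
  assumes "poly (Q \<beta>) u = 0" "poly (Q \<beta>) v = 0" "poly (Q \<beta>) w = 0"
    and "u \<noteq> v" "v \<noteq> w" "u \<noteq> w"
  shows "qroot \<beta> ` {1, 2, 3} = {u, v, w}"
proof -
  define l where "l = sorted_list_of_set {X. poly (Q \<beta>) X = 0}"
  have "finite {u, v, w}" "card {u, v, w} = 3"
    using assms(4-6) by simp_all
  then have "set l = {u, v, w}" "length l = 3"
    unfolding l_def Q_roots_eq[OF assms]
    by (simp_all only: set_sorted_list_of_set length_sorted_list_of_set)
  moreover from \<open>length l = 3\<close> obtain x y z where l: "l = [x, y, z]"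
    by (auto simp: numeral_3_eq_3 length_Suc_conv)
  moreover have "qroot \<beta> 1 = x" "qroot \<beta> 2 = y" "qroot \<beta> 3 = z"
    unfolding qroot_def l_def[symmetric] l by simp_all
  ultimately show ?thesis
    by simp
qed

lemma Q_root_exists: "\<exists>u. poly (Q \<beta>) u = 0"
proof -
  have "\<exists>u>- 1. u < 0 \<and> poly (Q \<beta>) u = 0"
    by (rule poly_IVT_neg) (auto simp: poly_Q)
  then show ?thesis
    by blast
qed

section \<open>The order-three map on ratios\<close>

lemma ratio_map_neq:
  assumes "u \<noteq> 0" "u \<noteq> - 1"
  shows "ratio_map u \<noteq> 0" "ratio_map u \<noteq> - 1"
  using assms by (auto simp: ratio_map_def field_simps)

lemma ratio_map_twice:
  assumes "u \<noteq> 0" "u \<noteq> - 1"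
  shows "ratio_map (ratio_map u) = - 1 / (1 + u)"
proof -
  have "1 + u \<noteq> 0"
    using assms by linarith
  then show ?thesis
    using assms by (simp add: ratio_map_def field_simps)
qed

lemma ratio_map_thrice:
  assumes "u \<noteq> 0" "u \<noteq> - 1"
  shows "ratio_map (ratio_map (ratio_map u)) = u"
proof -
  have "1 + u \<noteq> 0"
    using assms by linarith
  then show ?thesis
    unfolding ratio_map_twice[OF assms] using assms by (simp add: ratio_map_def field_simps)
qed

text \<open>Cleared of the denominator \<open>1 + u\<close>, this is a polynomial relation for the
  reciprocal of \<open>ratio_map u\<close>. It also holds at \<open>u = 0\<close>, where division by
  zero makes both sides \<open>0\<close>.\<close>

lemma inverse_ratio_map:
  assumes "u \<noteq> - 1"
  shows "(1 + u) * (1 / ratio_map u) = - u"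
proof -
  have "1 / ratio_map u = - (u / (1 + u))"
    unfolding ratio_map_def by (metis divide_divide_eq_right minus_divide_left minus_divide_right mult_1)
  moreover have "1 + u \<noteq> 0"
    using assms by linarith
  ultimately show ?thesis
    by simp
qed

text \<open>A fixed point would be a real root of \<open>u\<^sup>2 + u + 1\<close>, whose
  discriminant is negative.\<close>

lemma ratio_map_no_fixpoint:
  assumes "u \<noteq> 0"
  shows "ratio_map u \<noteq> u"
proof
  assume "ratio_map u = u"
  then have "u\<^sup>2 + u + 1 = 0"
    using assms by (simp add: ratio_map_def field_simps power2_eq_square)
  moreover have "u\<^sup>2 + u + 1 = (u + 1 / 2)\<^sup>2 + 3 / 4"
    by (simp add: power2_eq_square algebra_simps)
  ultimately show False
    using zero_le_power2[of "u + 1 / 2"] by linarith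
qed

text \<open>Substituting \<open>- (1 + u) / u\<close> and clearing the denominator
  \<open>u ^ 3\<close> reproduces the same cubic.\<close>

lemma Q_root_ratio_map:
  assumes "poly (Q \<beta>) u = 0"
  shows "poly (Q \<beta>) (ratio_map u) = 0"
proof -
  have "u \<noteq> 0"
    using Q_root_neq[OF assms] by simp
  then have "u * ratio_map u = - (1 + u)"
    by (simp add: ratio_map_def)
  then have "u ^ 3 * poly (Q \<beta>) (ratio_map u) = poly (Q \<beta>) u"
    unfolding poly_Q by algebra
  then show ?thesis
    using assms \<open>u \<noteq> 0\<close> by simp
qed

section \<open>Conjugating the root permutation to the quadratic map\<close>

text \<open>With \<open>X = 2 a x + b\<close> and \<open>Y = 2 a y + b\<close>, the equation \<open>g x = y\<close> becomes \<open>X\<^sup>2 - 2 Y = \<delta> + 7\<close>.\<close>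

lemma quad_map_eq_iff:
  assumes "a \<noteq> 0"
  shows "quad_map a b c x = y \<longleftrightarrow> (2 * a * x + b)\<^sup>2 - 2 * (2 * a * y + b) = delta a b c + 7"
proof -
  have "(2 * a * x + b)\<^sup>2 - 2 * (2 * a * y + b) - (delta a b c + 7) = 4 * a * (quad_map a b c x - y)"
    unfolding quad_map_def delta_def by algebra
  then show ?thesis
    using assms by (metis eq_iff_diff_eq_0 mult_eq_0_iff zero_neq_numeral)
qed

text \<open>This is the scaled equation \<open>X\<^sup>2 - 2 Y = \<delta> + 7\<close> for two
  consecutive orbit points, with \<open>\<beta>\<^sup>2\<close> in place of \<open>\<delta>\<close>.
  The difference of its sides, times \<open>u\<^sup>2 * (1 + u)\<close>, is
  \<open>- 4 * poly (Q \<beta>) u\<close>.\<close>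

lemma Q_root_square_identity:
  assumes "poly (Q \<beta>) u = 0"
  shows "(\<beta> + 1 + 2 / u)\<^sup>2 - 2 * (\<beta> + 1 + 2 / ratio_map u) = \<beta>\<^sup>2 + 7"
proof -
  have u: "u \<noteq> 0" "1 + u \<noteq> 0"
    using Q_root_neq[OF assms] by auto
  define i k where "i = 1 / u" and "k = 1 / ratio_map u"
  have "u * i = 1" "(1 + u) * k = - u"
    using u inverse_ratio_map[of u] by (auto simp: i_def k_def)
  then have "((\<beta> + 1 + 2 * i)\<^sup>2 - 2 * (\<beta> + 1 + 2 * k) - (\<beta>\<^sup>2 + 7)) * (u\<^sup>2 * (1 + u))
      = - 4 * poly (Q \<beta>) u"
    unfolding poly_Q by algebra
  then show ?thesis
    using u assms by (simp add: i_def k_def)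
qed

lemma cycle_point_scaled:
  assumes "a \<noteq> 0"
  shows "2 * a * cycle_point a b \<beta> u + b = \<beta> + 1 + 2 / u"
  using assms by (cases "u = 0") (simp_all add: cycle_point_def field_simps)

lemma cycle_point_eqI:
  assumes "a \<noteq> 0" "2 * a * x + b = \<beta> + 1 + 2 / u"
  shows "x = cycle_point a b \<beta> u"
proof -
  have "2 * a * x = 2 * a * cycle_point a b \<beta> u"
    using assms(2) cycle_point_scaled[OF assms(1), of b \<beta> u] by linarith
  then show ?thesis
    using assms(1) by simp
qed

lemma cycle_point_eq_iff:
  assumes "a \<noteq> 0" "u \<noteq> 0" "v \<noteq> 0"
  shows "cycle_point a b \<beta> u = cycle_point a b \<beta> v \<longleftrightarrow> u = v"
  using assms by (auto simp: cycle_point_def field_simps)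

lemma quad_map_cycle_point:
  assumes "a \<noteq> 0" "\<beta>\<^sup>2 = delta a b c" "poly (Q \<beta>) u = 0"
  shows "quad_map a b c (cycle_point a b \<beta> u) = cycle_point a b \<beta> (ratio_map u)"
  using Q_root_square_identity[OF assms(3)] assms(2)
  by (simp add: quad_map_eq_iff[OF assms(1)] cycle_point_scaled[OF assms(1)])

text \<open>No two neighbours agree, as there is no fixed point; if \<open>u\<close> equalled its
  second image, applying the map once more would make \<open>u\<close> fixed.\<close>

lemma ratio_orbit_distinct:
  assumes "u \<noteq> 0" "u \<noteq> - 1"
  shows "u \<noteq> ratio_map u" "ratio_map u \<noteq> ratio_map (ratio_map u)" "u \<noteq> ratio_map (ratio_map u)"
  using ratio_map_no_fixpoint assms ratio_map_neq ratio_map_thrice by metis+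

lemma orbit_rep_is_rep3:
  assumes "a \<noteq> 0" "\<beta>\<^sup>2 = delta a b c" "poly (Q \<beta>) u = 0"
  shows "is_rep3 (quad_map a b c) (orbit_rep a b \<beta> u)"
proof -
  note u = Q_root_neq[OF assms(3)]
  note v = ratio_map_neq[OF u]
  note w = ratio_map_neq[OF v]
  show ?thesis
    using ratio_orbit_distinct[OF u] u v w assms ratio_map_thrice[OF u]
    by (simp add: is_rep3_def orbit_rep_def cycle_point_eq_iff quad_map_cycle_point Q_root_ratio_map)
qed

section \<open>The cycle with parameter \<open>\<beta>\<close>\<close>

lemma cycle_points_cyclic_class: "cycle_points (cyclic_class (x, y, z)) = {x, y, z}"
  by (auto simp: cycle_points_def cyclic_class_def)

text \<open>One common point suffices: iterating \<open>g\<close> from it produces the other two in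
  order.\<close>

lemma three_cycle_determined_by_points:
  assumes "C \<in> three_cycles g" "D \<in> three_cycles g" "cycle_points C = cycle_points D"
  shows "C = D"
proof -
  obtain x y z where C: "C = cyclic_class (x, y, z)" "is_rep3 g (x, y, z)"
    using assms(1) unfolding three_cycles_def by (metis image_iff mem_Collect_eq prod_cases3)
  obtain x' y' z' where D: "D = cyclic_class (x', y', z')" "is_rep3 g (x', y', z')"
    using assms(2) unfolding three_cycles_def by (metis image_iff mem_Collect_eq prod_cases3)
  have "x' \<in> {x, y, z}"
    using assms(3) by (auto simp: C D cycle_points_cyclic_class)
  moreover have "g x = y" "g y = z" "g z = x" "g x' = y'" "g y' = z'"
    using C(2) D(2) by (simp_all add: is_rep3_def)
  ultimately have "(x', y', z') \<in> {(x, y, z), (y, z, x), (z, x, y)}"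
    by (elim insertE emptyE) simp_all
  then show ?thesis
    unfolding C(1) D(1) cyclic_class_def
    by (elim insertE emptyE) (simp_all add: insert_commute)
qed

text \<open>Evaluates the definite description: the orbit of any single root exhausts the roots, so
  its image has the prescribed points, and the points determine the cycle.\<close>

lemma cycle_of_eq:
  assumes "a \<noteq> 0" "\<beta>\<^sup>2 = delta a b c" "poly (Q \<beta>) u = 0"
  shows "cycle_of a b c \<beta> = cyclic_class (orbit_rep a b \<beta> u)"
proof -
  let ?C = "cyclic_class (orbit_rep a b \<beta> u)"
  let ?S = "(\<lambda>i. (- b + \<beta> + 1) / (2 * a) + 1 / (a * qroot \<beta> i)) ` {1, 2, 3}"
  note u = Q_root_neq[OF assms(3)]
  have "?S = cycle_point a b \<beta> ` qroot \<beta> ` {1, 2, 3}"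
    by (simp add: cycle_point_def)
  also have "qroot \<beta> ` {1, 2, 3} = {u, ratio_map u, ratio_map (ratio_map u)}"
    using assms(3) ratio_orbit_distinct[OF u] by (intro qroot_image Q_root_ratio_map)
  finally have "cycle_points ?C = ?S"
    by (simp add: orbit_rep_def cycle_points_cyclic_class)
  moreover have "?C \<in> three_cycles (quad_map a b c)"
    using orbit_rep_is_rep3[OF assms] by (simp add: three_cycles_def)
  ultimately show ?thesis
    unfolding cycle_of_def by (intro the_equality) (metis three_cycle_determined_by_points)+
qed

section \<open>Ratios of a given representative\<close>

text \<open>Each ratio is a difference quotient of the map between consecutive points, and the
  difference quotient of a quadratic is affine in the sum of its arguments.\<close>

lemma rep3_ratio:
  assumes "a \<noteq> 0" "is_rep3 (quad_map a b c) (x, y, z)" "r = (z - y) / (y - x)"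
  shows "r = a * (x + y) + b" "r \<noteq> 0" "r \<noteq> - 1"
    and "ratio_map r = a * (y + z) + b" "ratio_map (ratio_map r) = a * (z + x) + b"
proof -
  have ne: "x \<noteq> y" "y \<noteq> z" "x \<noteq> z"
    and g: "quad_map a b c x = y" "quad_map a b c y = z" "quad_map a b c z = x"
    using assms(2) by (auto simp: is_rep3_def)
  have diff: "quad_map a b c v - quad_map a b c u = (v - u) * (a * (u + v) + b)" for u v
    unfolding quad_map_def by algebra
  show "r = a * (x + y) + b"
    using diff[of y x] ne unfolding g assms(3) by (simp add: add.commute)
  show r0: "r \<noteq> 0"
    using ne assms(3) by simp
  show r1: "r \<noteq> - 1"
  proof
    assume "r = - 1"
    then have "z - y = - (y - x)"
      using ne assms(3) by (simp add: divide_eq_eq)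
    then show False
      using ne by simp
  qed
  have r_plus_1: "1 + r = (z - x) / (y - x)"
    using ne unfolding assms(3) by (simp add: field_simps)
  have "ratio_map r = (x - z) / (z - y)"
    using ne unfolding ratio_map_def r_plus_1 unfolding assms(3) by (simp add: minus_divide_left)
  then show "ratio_map r = a * (y + z) + b"
    using diff[of z y] ne unfolding g by simp
  have "ratio_map (ratio_map r) = - 1 / (1 + r)"
    by (rule ratio_map_twice[OF r0 r1])
  also have "\<dots> = - ((y - x) / (z - x))"
    unfolding r_plus_1 by (simp add: minus_divide_left)
  also have "\<dots> = (y - x) / (x - z)"
    by (simp add: minus_divide_right)
  finally show "ratio_map (ratio_map r) = a * (z + x) + b"
    using diff[of x z] ne unfolding g by simp
qed

lemma rep3_eq_orbit_rep:
  assumes "a \<noteq> 0" "is_rep3 (quad_map a b c) (x, y, z)" "r = (z - y) / (y - x)"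
    and root: "poly (Q \<beta>) r = 0"
  shows "(x, y, z) = orbit_rep a b \<beta> r" "delta a b c = \<beta>\<^sup>2"
proof -
  note ratio = rep3_ratio[OF assms(1-3)]
  note r = ratio(2,3)
  note s = ratio_map_neq[OF r]
  \<comment> \<open>Vieta: the three roots of \<open>Q \<beta>\<close> add up to
    \<open>\<beta> - 1\<close>.\<close>
  have sum: "\<beta> = v + ratio_map v + ratio_map (ratio_map v) + 1" if "poly (Q \<beta>) v = 0" for v
  proof -
    note v = Q_root_neq[OF that]
    have v': "1 + v \<noteq> 0"
      using v by auto
    have "v * ratio_map v = - (1 + v)" "(1 + v) * ratio_map (ratio_map v) = - 1"
      unfolding ratio_map_twice[OF v] using v v' by (simp_all add: ratio_map_def)
    then have "(v + ratio_map v + ratio_map (ratio_map v) + 1 - \<beta>) * (v * (1 + v)) = poly (Q \<beta>) v"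
      unfolding poly_Q by algebra
    then show ?thesis
      using v v' that by simp
  qed
  have inv: "2 / v = - 2 - 2 * ratio_map v" if "v \<noteq> 0" for v
    using that by (simp add: ratio_map_def field_simps)
  \<comment> \<open>Both sides equal \<open>r - ratio_map r + ratio_map (ratio_map r)\<close>; the
    next two equations are its cyclic shifts.\<close>
  have "2 * a * x + b = \<beta> + 1 + 2 / r"
    unfolding inv[OF r(1)] using sum[OF root] ratio by (simp add: algebra_simps)
  moreover have "2 * a * y + b = \<beta> + 1 + 2 / ratio_map r"
    unfolding inv[OF s(1)] using sum[OF root] ratio by (simp add: algebra_simps)
  moreover have "2 * a * z + b = \<beta> + 1 + 2 / ratio_map (ratio_map r)"
    unfolding inv[OF ratio_map_neq(1)[OF s]] ratio_map_thrice[OF r]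
    using sum[OF root] ratio by (simp add: algebra_simps)
  ultimately have eq: "x = cycle_point a b \<beta> r" "y = cycle_point a b \<beta> (ratio_map r)"
    "z = cycle_point a b \<beta> (ratio_map (ratio_map r))"
    by (auto intro: cycle_point_eqI[OF assms(1)])
  then show "(x, y, z) = orbit_rep a b \<beta> r"
    by (simp add: orbit_rep_def)
  \<comment> \<open>In scaled form this equation reads
    \<open>\<beta>\<^sup>2 + 7 = delta a b c + 7\<close>.\<close>
  have "quad_map a b c x = y"
    using assms(2) by (simp add: is_rep3_def)
  then show "delta a b c = \<beta>\<^sup>2"
    unfolding quad_map_eq_iff[OF assms(1)] eq cycle_point_scaled[OF assms(1)]
      Q_root_square_identity[OF root] by simp
qed

text \<open>The common offset of the three points cancels in the differences, leaving an identity
  between reciprocals of \<open>u\<close> and its images.\<close>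

lemma ratio_orbit_rep:
  assumes "a \<noteq> 0" "\<beta>\<^sup>2 = delta a b c" "poly (Q \<beta>) u = 0" "orbit_rep a b \<beta> u = (x, y, z)"
  shows "(z - y) / (y - x) = u"
proof -
  note u = Q_root_neq[OF assms(3)]
  have u': "1 + u \<noteq> 0"
    using u by auto
  have "x = (- b + \<beta> + 1) / (2 * a) + 1 / (a * u)"
    "y = (- b + \<beta> + 1) / (2 * a) + 1 / (a * ratio_map u)"
    "z = (- b + \<beta> + 1) / (2 * a) + 1 / (a * (- 1 / (1 + u)))"
    using assms(4) by (auto simp: orbit_rep_def cycle_point_def ratio_map_twice[OF u])
  then have "z - y = (1 / (- 1 / (1 + u)) - 1 / ratio_map u) / a" "y - x = (1 / ratio_map u - 1 / u) / a"
    by (simp_all add: diff_divide_distrib add_divide_distrib mult.commute)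
  moreover have "1 / (- 1 / (1 + u)) - 1 / ratio_map u = u * (1 / ratio_map u - 1 / u)"
  proof -
    define k where "k = 1 / ratio_map u"
    have "(1 + u) * k = - u"
      using u inverse_ratio_map[of u] by (simp add: k_def)
    then show ?thesis
      using u by (simp add: algebra_simps flip: k_def)
  qed
  moreover have "y \<noteq> x"
    using orbit_rep_is_rep3[OF assms(1-3)] assms(4) by (simp add: is_rep3_def)
  ultimately have "z - y = u * (y - x)" "y - x \<noteq> 0"
    by (simp_all only: times_divide_eq_right right_minus_eq not_False_eq_True)
  then show ?thesis
    by simp
qed

lemma mem_cycle_of_iff:
  assumes "a \<noteq> 0" "is_rep3 (quad_map a b c) (x, y, z)" "r = (z - y) / (y - x)"
    and "\<beta>\<^sup>2 = delta a b c"
  shows "(x, y, z) \<in> cycle_of a b c \<beta> \<longleftrightarrow> poly (Q \<beta>) r = 0"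
proof
  assume "poly (Q \<beta>) r = 0"
  then show "(x, y, z) \<in> cycle_of a b c \<beta>"
    unfolding cycle_of_eq[OF assms(1,4) \<open>poly (Q \<beta>) r = 0\<close>]
      rep3_eq_orbit_rep(1)[OF assms(1-3) \<open>poly (Q \<beta>) r = 0\<close>, symmetric]
    by (simp add: cyclic_class_def)
next
  assume mem: "(x, y, z) \<in> cycle_of a b c \<beta>"
  obtain u where u: "poly (Q \<beta>) u = 0"
    using Q_root_exists by blast
  note u_neq = Q_root_neq[OF u]
  have "(x, y, z) \<in> cyclic_class (orbit_rep a b \<beta> u)"
    using mem cycle_of_eq[OF assms(1,4) u] by simp
  \<comment> \<open>Rotating the triple amounts to replacing \<open>u\<close> by one of its images
    under \<open>ratio_map\<close>.\<close>
  then have "\<exists>v\<in>{u, ratio_map u, ratio_map (ratio_map u)}. orbit_rep a b \<beta> v = (x, y, z)"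
    by (auto simp: orbit_rep_def cyclic_class_def ratio_map_thrice[OF u_neq])
  then obtain v where "poly (Q \<beta>) v = 0" "orbit_rep a b \<beta> v = (x, y, z)"
    using u Q_root_ratio_map by blast
  then show "poly (Q \<beta>) r = 0"
    using ratio_orbit_rep[OF assms(1,4)] assms(3) by simp
qed

section \<open>Location of the roots of \<open>Q 0\<close> and signs\<close>

text \<open>Sign changes of \<open>Q 0\<close> at the ends of the intervals of radius
  \<open>0.001\<close> about the approximate values give three ordered roots.\<close>

lemma qroot_0_bounds:
  shows "qroot 0 1 \<in> {- 1.802<..<- 1.8}" "qroot 0 2 \<in> {- 0.446<..<- 0.444}"
    and "qroot 0 3 \<in> {1.245<..<1.247}"
    and "poly (Q 0) X = (X - qroot 0 1) * (X - qroot 0 2) * (X - qroot 0 3)"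
proof -
  have "\<exists>u>- 1.802. u < - 1.8 \<and> poly (Q 0) u = 0"
    by (rule poly_IVT_pos) (auto simp: poly_Q power2_eq_square power3_eq_cube)
  then obtain u where u: "- 1.802 < u" "u < - 1.8" "poly (Q 0) u = 0"
    by blast
  have "\<exists>v>- 0.446. v < - 0.444 \<and> poly (Q 0) v = 0"
    by (rule poly_IVT_neg) (auto simp: poly_Q power2_eq_square power3_eq_cube)
  then obtain v where v: "- 0.446 < v" "v < - 0.444" "poly (Q 0) v = 0"
    by blast
  have "\<exists>w>1.245. w < 1.247 \<and> poly (Q 0) w = 0"
    by (rule poly_IVT_pos) (auto simp: poly_Q power2_eq_square power3_eq_cube)
  then obtain w where w: "1.245 < w" "w < 1.247" "poly (Q 0) w = 0"
    by blast
  have less: "u < v" "v < w"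
    using u v w by auto
  have eq: "qroot 0 1 = u" "qroot 0 2 = v" "qroot 0 3 = w"
    using qroot_eq[OF u(3) v(3) w(3) less] by auto
  show "qroot 0 1 \<in> {- 1.802<..<- 1.8}" "qroot 0 2 \<in> {- 0.446<..<- 0.444}"
    "qroot 0 3 \<in> {1.245<..<1.247}"
    unfolding eq using u v w by auto
  show "poly (Q 0) X = (X - qroot 0 1) * (X - qroot 0 2) * (X - qroot 0 3)"
    unfolding eq using u v w less by (intro Q_factorization) auto
qed

lemma quotient_pos_iff:
  fixes r q1 q2 q3 :: real
  assumes "q1 < - 1" "- 1 < q2" "q2 < 0" "0 < q3" "r \<noteq> 0" "r \<noteq> - 1"
  shows "(r - q1) * (r - q2) * (r - q3) / (r * (r + 1)) > 0 \<longleftrightarrow>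
    r \<in> {q1<..<- 1} \<union> {q2<..<0} \<union> {q3<..}"
proof -
  define P where "P = (r - q1) * (r - q2) * (r - q3) / (r * (r + 1))"
  have sgn_P: "sgn P = sgn (r - q1) * sgn (r - q2) * sgn (r - q3) / (sgn r * sgn (r + 1))"
    by (simp add: P_def sgn_mult sgn_divide)
  \<comment> \<open>The zeros and poles are ordered \<open>q1 < - 1 < q2 < 0 < q3\<close>, and every
    factor has constant sign between neighbours.\<close>
  consider "r < q1" | "r = q1" | "q1 < r" "r < - 1" | "- 1 < r" "r < q2" | "r = q2"
    | "q2 < r" "r < 0" | "0 < r" "r < q3" | "r = q3" | "q3 < r"
    using assms by linarith
  then have "sgn P = 1 \<longleftrightarrow> r \<in> {q1<..<- 1} \<union> {q2<..<0} \<union> {q3<..}"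
    unfolding sgn_P by cases (use assms in \<open>simp_all add: sgn_if\<close>)
  then show ?thesis
    unfolding P_def[symmetric] sgn_1_pos .
qed

theorem theorem2p4:
  fixes a b c x y z r q1 q2 q3 :: real
  assumes "a \<noteq> 0"
    and "is_rep3 (quad_map a b c) (x, y, z)"
    and "r = (z - y) / (y - x)"
    and "q1 = qroot 0 1" and "q2 = qroot 0 2" and "q3 = qroot 0 3"
  shows "(\<bar>q1 - (- 1.801)\<bar> < 0.001 \<and> \<bar>q2 - (- 0.445)\<bar> < 0.001 \<and> \<bar>q3 - 1.246\<bar> < 0.001) \<and>
    (delta a b c = 0 \<longleftrightarrow> r \<in> {q1, q2, q3}) \<and>
    ((delta a b c > 0 \<and> (x, y, z) \<in> C_pos a b c) \<longleftrightarrow>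
       r \<in> {q1<..<- 1} \<union> {q2<..<0} \<union> {q3<..}) \<and>
    ((delta a b c > 0 \<and> (x, y, z) \<in> C_neg a b c) \<longleftrightarrow>
       r \<in> {..<q1} \<union> {- 1<..<q2} \<union> {0<..<q3})"
proof -
  note bounds = qroot_0_bounds(1-3)[folded assms(4-6)]
  note r = rep3_ratio(2,3)[OF assms(1-3)]
  \<comment> \<open>The only parameter for which \<open>r\<close> is a root.\<close>
  define \<beta> where "\<beta> = poly (Q 0) r / (r * (r + 1))"
  have root_iff: "poly (Q \<gamma>) r = 0 \<longleftrightarrow> \<gamma> = \<beta>" for \<gamma>
    using Q_root_iff[OF r] by (simp add: \<beta>_def)
  have \<beta>: "\<beta> = (r - q1) * (r - q2) * (r - q3) / (r * (r + 1))"
    by (simp add: \<beta>_def assms(4-6) qroot_0_bounds(4))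
  have delta: "delta a b c = \<beta>\<^sup>2"
    using rep3_eq_orbit_rep(2)[OF assms(1-3)] root_iff by blast
  have "r + 1 \<noteq> 0"
    using r by linarith
  then have zero: "\<beta> = 0 \<longleftrightarrow> r \<in> {q1, q2, q3}"
    using r by (auto simp: \<beta>)
  have pos: "\<beta> > 0 \<longleftrightarrow> r \<in> {q1<..<- 1} \<union> {q2<..<0} \<union> {q3<..}"
    unfolding \<beta> using bounds r by (intro quotient_pos_iff) auto
  have neg: "\<beta> < 0 \<longleftrightarrow> r \<in> {..<q1} \<union> {- 1<..<q2} \<union> {0<..<q3}"
  proof -
    have "\<beta> < 0 \<longleftrightarrow> \<not> (\<beta> = 0 \<or> \<beta> > 0)"
      by auto
    also have "\<dots> \<longleftrightarrow> r \<in> {..<q1} \<union> {- 1<..<q2} \<union> {0<..<q3}"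
      unfolding zero pos using bounds r by auto
    finally show ?thesis .
  qed
  \<comment> \<open>The square root of \<open>delta a b c\<close> is
    \<open>\<bar>\<beta>\<bar>\<close>, so membership is a sign condition. Both conditions hold at
    \<open>\<beta> = 0\<close>, which \<open>delta a b c > 0\<close> excludes.\<close>
  have "(x, y, z) \<in> C_pos a b c \<longleftrightarrow> \<bar>\<beta>\<bar> = \<beta>" "(x, y, z) \<in> C_neg a b c \<longleftrightarrow> - \<bar>\<beta>\<bar> = \<beta>"
    unfolding C_pos_def C_neg_def
    by (simp_all add: mem_cycle_of_iff[OF assms(1-3)] root_iff delta)
  then have "delta a b c > 0 \<and> (x, y, z) \<in> C_pos a b c \<longleftrightarrow> \<beta> > 0"
    "delta a b c > 0 \<and> (x, y, z) \<in> C_neg a b c \<longleftrightarrow> \<beta> < 0"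
    by (auto simp: delta)
  moreover have "\<bar>q1 - (- 1.801)\<bar> < 0.001" "\<bar>q2 - (- 0.445)\<bar> < 0.001" "\<bar>q3 - 1.246\<bar> < 0.001"
    using bounds by (auto simp: abs_if)
  ultimately show ?thesis
    using zero pos neg delta by simp
qed

end
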